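(* Let $G$ be a connected, biconnected, 3-regular series-parallel graph (multiple edges allowed, no self-loops). Then there exist vertices $p,q\in V_G$ such that the two-terminal series-parallel graph $(G,p,q)$ is obtainable from $(D_3,p,q)$ by a finite sequence of applications of the operation $\tau$.
   Context: Graphs are connected and without self-loops; multi-edges are allowed. The dipole $D_n$ is the graph with two vertices joined by $n$ parallel edges; $(D_3,p,q)$ denotes $D_3$ with its two vertices designated as roots $p$ and $q$. The operation $\tau$ (a "dmt-step", double the middle third) on a graph: choose an arbitrary edge $e$, subdivide it by two new vertices into three consecutive edges, and add a new edge parallel to the middle one of these three edges (joining the two new vertices); the roots are unchanged. A two-terminal series-parallel graph is a graph $G$ with two distinguished vertices $(G,p,q)$ (source root $p$, target root $q$) defined recursively: $(K_2,p,q)$, where $p,q$ are the two vertices of $K_2$, is two-terminal series-parallel; if $(G,p,q)$ and $(G',p',q')$ are two-terminal series-parallel, then so is their series composition (identify $q$ with $p'$; the new roots are $p$ and $q'$) and their parallel composition (identify $p$ with $p'$ and $q$ with $q'$; the new roots are the merged vertices). A graph $G$ is series-parallel if there exist vertices $p,q$ of $G$ such that $(G,p,q)$ is a two-terminal series-parallel graph. *)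

theory Defs
  imports "HOL-Library.Multiset"
begin

text \<open>
  A multigraph is a vertex set together with a multiset of edges, an edge being the set of its two
  endpoints; parallel edges are repeated occurrences of the same two-element set.
\<close>

datatype 'v mgraph = MGraph (verts: "'v set") (edges: "'v set multiset")

definition loopfree_mgraph :: "'v mgraph \<Rightarrow> bool" where
  "loopfree_mgraph G \<longleftrightarrow>
     finite (verts G) \<and> (\<forall>e \<in># edges G. e \<subseteq> verts G \<and> card e = 2)"

definition degree :: "'v mgraph \<Rightarrow> 'v \<Rightarrow> nat" where
  "degree G v = size {#e \<in># edges G. v \<in> e#}"

definition regular :: "nat \<Rightarrow> 'v mgraph \<Rightarrow> bool" where
  "regular d G \<longleftrightarrow> (\<forall>v \<in> verts G. degree G v = d)"

definition adjacent :: "'v mgraph \<Rightarrow> 'v \<Rightarrow> 'v \<Rightarrow> bool" where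
  "adjacent G u v \<longleftrightarrow> {u, v} \<in># edges G"

definition joined :: "'v mgraph \<Rightarrow> 'v \<Rightarrow> 'v \<Rightarrow> bool" where
  "joined G = (adjacent G)\<^sup>*\<^sup>*"

definition connected_graph :: "'v mgraph \<Rightarrow> bool" where
  "connected_graph G \<longleftrightarrow> verts G \<noteq> {} \<and> (\<forall>u \<in> verts G. \<forall>v \<in> verts G. joined G u v)"

definition del_vertex :: "'v mgraph \<Rightarrow> 'v \<Rightarrow> 'v mgraph" where
  "del_vertex G v = MGraph (verts G - {v}) {#e \<in># edges G. v \<notin> e#}"

definition cut_vertex :: "'v mgraph \<Rightarrow> 'v \<Rightarrow> bool" where
  "cut_vertex G c \<longleftrightarrow> c \<in> verts G \<and>
     (\<exists>u \<in> verts G - {c}. \<exists>v \<in> verts G - {c}. joined G u v \<and> \<not> joined (del_vertex G c) u v)"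

text \<open>
  With this convention the dipoles with at least one edge are biconnected; in particular so is
  the dipole with three edges.
\<close>

definition biconnected :: "'v mgraph \<Rightarrow> bool" where
  "biconnected G \<longleftrightarrow> connected_graph G \<and> (\<forall>v. \<not> cut_vertex G v)"

definition dipole :: "nat \<Rightarrow> 'v \<Rightarrow> 'v \<Rightarrow> 'v mgraph" where
  "dipole n p q = MGraph {p, q} (replicate_mset n {p, q})"

definition glue :: "'v mgraph \<Rightarrow> 'v mgraph \<Rightarrow> 'v mgraph" where
  "glue G H = MGraph (verts G \<union> verts H) (edges G + edges H)"

text \<open>
  Identification of roots is expressed by gluing two graphs that share exactly the vertices to be
  identified.  Vertices can always be renamed so that this is the case, and the predicate is
  invariant under renaming of vertices.  The single-edge graph \<open>dipole 1 p q\<close> is $K_2$.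
\<close>

inductive two_terminal_sp :: "'v mgraph \<Rightarrow> 'v \<Rightarrow> 'v \<Rightarrow> bool" where
  K2: "p \<noteq> q \<Longrightarrow> two_terminal_sp (dipole 1 p q) p q"
| series: "\<lbrakk>two_terminal_sp G p m; two_terminal_sp H m q; verts G \<inter> verts H = {m}\<rbrakk>
     \<Longrightarrow> two_terminal_sp (glue G H) p q"
| parallel: "\<lbrakk>two_terminal_sp G p q; two_terminal_sp H p q; verts G \<inter> verts H = {p, q}\<rbrakk>
     \<Longrightarrow> two_terminal_sp (glue G H) p q"

definition series_parallel :: "'v mgraph \<Rightarrow> bool" where
  "series_parallel G \<longleftrightarrow> (\<exists>p \<in> verts G. \<exists>q \<in> verts G. two_terminal_sp G p q)"

text \<open>
  The operation $\tau$ on rooted graphs: one copy of the edge \<open>{u, v}\<close> is replaced by the path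
  \<open>u, x, y, v\<close> with its middle edge doubled.  The new vertices \<open>x\<close>, \<open>y\<close> are arbitrary fresh
  elements, so every concrete copy of the resulting graph that retains the old vertices arises.
\<close>

inductive dmt_step :: "'v mgraph \<times> 'v \<times> 'v \<Rightarrow> 'v mgraph \<times> 'v \<times> 'v \<Rightarrow> bool" where
  "\<lbrakk>{u, v} \<in># edges G; u \<noteq> v; x \<notin> verts G; y \<notin> verts G; x \<noteq> y\<rbrakk>
     \<Longrightarrow> dmt_step (G, p, q)
          (MGraph (verts G \<union> {x, y})
             (edges G - {#{u, v}#} + {#{u, x}, {x, y}, {x, y}, {y, v}#}), p, q)"

end

theory Submission
  imports Defs
begin

text \<open>
  A biconnected graph is not a series composition at top level, so \<open>G\<close> is the parallel composition
  of two networks whose roots have degree 1 or 2 and whose other vertices have degree 3.  By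
  structural induction such a network arises by dmt-steps from a short necklace
  \<open>p = p' - q' = q\<close>, where the double edge at a root is absent when that root has degree 1, or from
  a double edge \<open>p = q\<close>.  Two of these glued in parallel form either the dipole with three edges
  or a 4-cycle with two opposite edges doubled.  The latter is one dmt-step away from a dipole
  whose roots are the ends of a doubled edge, so the roots may have to change.
\<close>

section \<open>dmt-steps on graphs without roots\<close>

definition dmt :: "'v mgraph \<Rightarrow> 'v \<Rightarrow> 'v \<Rightarrow> 'v \<Rightarrow> 'v \<Rightarrow> 'v mgraph" where
  "dmt G u v x y = MGraph (verts G \<union> {x, y})
     (edges G - {#{u, v}#} + {#{u, x}, {x, y}, {x, y}, {y, v}#})"

text \<open>A dmt-step never consults or moves the roots. Dropping them lets pieces with different
  roots be glued, and lets the final roots be chosen only after the derivation is known.\<close>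

inductive unrooted_step :: "'v mgraph \<Rightarrow> 'v mgraph \<Rightarrow> bool" where
  "\<lbrakk>{u, v} \<in># edges G; u \<noteq> v; x \<notin> verts G; y \<notin> verts G; x \<noteq> y\<rbrakk>
     \<Longrightarrow> unrooted_step G (dmt G u v x y)"

abbreviation derives :: "'v mgraph \<Rightarrow> 'v mgraph \<Rightarrow> bool" where
  "derives \<equiv> unrooted_step\<^sup>*\<^sup>*"

text \<open>The result is a separate equation, so that a step can be recognised in a target written
  as a \<open>glue\<close> of smaller graphs.\<close>

lemma unrooted_step_eqI:
  assumes "{u, v} \<in># edges G" "u \<noteq> v" "x \<notin> verts G" "y \<notin> verts G" "x \<noteq> y" "H = dmt G u v x y"
  shows "unrooted_step G H"
  using assms unrooted_step.intros by fast

lemma derives_dmt_step: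
  assumes "derives G H"
  shows "dmt_step\<^sup>*\<^sup>* (G, p, q) (H, p, q)"
  using assms
proof induction
  case (step H K)
  from step.hyps(2) have "dmt_step (H, p, q) (K, p, q)"
    by cases (simp only: dmt_def dmt_step.intros not_False_eq_True)
  with step.IH show ?case by simp
qed simp

lemma derives_verts_mono: "derives G H \<Longrightarrow> verts G \<subseteq> verts H"
  by (induction rule: rtranclp_induct) (auto simp: dmt_def elim!: unrooted_step.cases)

section \<open>Derivations inside glued graphs\<close>

lemma verts_glue [simp]: "verts (glue G H) = verts G \<union> verts H"
  and edges_glue [simp]: "edges (glue G H) = edges G + edges H"
  by (simp_all add: glue_def)

lemma glue_commute: "glue G H = glue H G"
  by (simp add: glue_def Un_commute add.commute)

lemma dmt_glue: "{u, v} \<in># edges G \<Longrightarrow> dmt (glue G H) u v x y = glue (dmt G u v x y) H"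
  by (auto simp: dmt_def glue_def)

lemma dmt_glue_right: "{u, v} \<in># edges H \<Longrightarrow> dmt (glue G H) u v x y = glue G (dmt H u v x y)"
  by (simp add: glue_commute[of G] dmt_glue)

lemma degree_glue: "degree (glue G H) v = degree G v + degree H v"
  by (simp add: degree_def)

text \<open>The second assumption keeps the vertices created on the way to \<open>G'\<close> away
  from \<open>H\<close>; hence each step stays fresh, and thus legal, when \<open>H\<close> is
  attached.\<close>

lemma derives_glue_left:
  assumes "derives G G'" "verts G' \<inter> verts H \<subseteq> verts G"
  shows "derives (glue G H) (glue G' H)"
  using assms
proof (induction rule: rtranclp_induct)
  case (step K L)
  from step.hyps(2) obtain u v x y where
    L: "L = dmt K u v x y" and uv: "{u, v} \<in># edges K" "u \<noteq> v"
    and xy: "x \<notin> verts K" "y \<notin> verts K" "x \<noteq> y"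
    by (auto elim: unrooted_step.cases)
  have sub: "verts G \<subseteq> verts K" using step.hyps(1) by (rule derives_verts_mono)
  have "x \<notin> verts H" "y \<notin> verts H" using step.prems sub xy by (auto simp: L dmt_def)
  then have "unrooted_step (glue K H) (glue L H)"
    using uv xy by (intro unrooted_step_eqI[of u v _ x y]) (auto simp: L dmt_glue)
  moreover have "derives (glue G H) (glue K H)"
    using step.IH step.prems by (auto simp: L dmt_def)
  ultimately show ?case by simp
qed simp

text \<open>\<open>G\<close> is developed first with \<open>H\<close> attached, then
  \<open>H\<close> with the finished \<open>G'\<close> attached. Vertex sets only grow, so the
  common-vertex assumption covers both rounds.\<close>

lemma derives_glue:
  assumes "derives G G'" "derives H H'" "verts G' \<inter> verts H' \<subseteq> verts G \<inter> verts H"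
  shows "derives (glue G H) (glue G' H')"
proof -
  have "verts H \<subseteq> verts H'" using assms(2) by (rule derives_verts_mono)
  then have "derives (glue G H) (glue G' H)"
    using assms by (intro derives_glue_left) auto
  moreover have "derives (glue H G') (glue H' G')"
    using assms by (intro derives_glue_left) auto
  ultimately show ?thesis by (simp add: glue_commute[of G'])
qed

section \<open>Roots and degrees in two-terminal networks\<close>

lemma two_terminal_sp_basic:
  assumes "two_terminal_sp G p q"
  shows two_terminal_sp_neq: "p \<noteq> q"
    and two_terminal_sp_source: "p \<in> verts G"
    and two_terminal_sp_target: "q \<in> verts G"
    and two_terminal_sp_edges: "e \<in># edges G \<Longrightarrow> e \<subseteq> verts G"
proof -
  have "p \<noteq> q \<and> p \<in> verts G \<and> q \<in> verts G \<and> (\<forall>e \<in># edges G. e \<subseteq> verts G)"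
    using assms by induction (auto simp: dipole_def)
  then show "p \<noteq> q" "p \<in> verts G" "q \<in> verts G" "e \<in># edges G \<Longrightarrow> e \<subseteq> verts G"
    by auto
qed

lemma two_terminal_sp_degree_pos:
  assumes "two_terminal_sp G p q"
  shows "1 \<le> degree G p" "1 \<le> degree G q"
proof -
  have "1 \<le> degree G p \<and> 1 \<le> degree G q"
    using assms by induction (auto simp: degree_glue, auto simp: dipole_def degree_def)
  then show "1 \<le> degree G p" "1 \<le> degree G q" by auto
qed

text \<open>Together with \<open>degree_glue\<close>: a vertex private to one piece has the same
  degree in the glued graph as in that piece.\<close>

lemma degree_outside:
  assumes "two_terminal_sp G p q" "v \<notin> verts G"
  shows "degree G v = 0"
  using two_terminal_sp_edges[OF assms(1)] assms(2) by (auto simp: degree_def)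

section \<open>dmt-steps preserve two-terminal series-parallel networks\<close>

lemma two_terminal_sp_double_path:
  assumes "distinct [p, x, y, q]"
  shows "two_terminal_sp (MGraph {p, x, y, q} {#{p, x}, {x, y}, {x, y}, {y, q}#}) p q"
proof -
  have "two_terminal_sp (glue (dipole 1 x y) (dipole 1 x y)) x y"
    using assms by (intro parallel K2) (auto simp: dipole_def)
  then have "two_terminal_sp (glue (dipole 1 p x) (glue (dipole 1 x y) (dipole 1 x y))) p y"
    by (rule series[OF K2, rotated]) (use assms in \<open>auto simp: dipole_def\<close>)
  then have "two_terminal_sp (glue (glue (dipole 1 p x) (glue (dipole 1 x y) (dipole 1 x y)))
      (dipole 1 y q)) p q"
    by (rule series[OF _ K2]) (use assms in \<open>auto simp: dipole_def\<close>)
  then show ?thesis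
    by (simp add: glue_def dipole_def insert_commute add_mset_commute)
qed

text \<open>The replaced edge belongs to one piece of the composition, and since \<open>x\<close>
  and \<open>y\<close> are fresh for the whole graph the pieces still meet in the same vertices. At
  a single edge the outcome is the series composition of an edge, a double edge and an edge.\<close>

lemma two_terminal_sp_dmt:
  assumes "two_terminal_sp G p q" "{u, v} \<in># edges G" "u \<noteq> v" "x \<notin> verts G" "y \<notin> verts G" "x \<noteq> y"
  shows "two_terminal_sp (dmt G u v x y) p q"
  using assms
proof (induction arbitrary: u v x y)
  case (K2 p q)
  \<comment> \<open>Edges are unordered, so \<open>u\<close> may be the target root; the path from
    \<open>p\<close> then meets \<open>y\<close> before \<open>x\<close>.\<close>
  then consider "u = p" "v = q" | "u = q" "v = p" by (auto simp: dipole_def doubleton_eq_iff)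
  then show ?case
  proof cases
    case 1
    then show ?thesis using two_terminal_sp_double_path[of p x y q] K2
      by (auto simp: dmt_def dipole_def insert_commute add_mset_commute)
  next
    case 2
    then show ?thesis using two_terminal_sp_double_path[of p y x q] K2
      by (auto simp: dmt_def dipole_def insert_commute add_mset_commute)
  qed
next
  case (series G p m H q)
  from series.prems(1) consider "{u, v} \<in># edges G" | "{u, v} \<in># edges H" by auto
  then show ?case
  proof cases
    case 1
    have "verts (dmt G u v x y) \<inter> verts H = {m}" using series.hyps(3) series.prems by (simp add: dmt_def)
    then have "two_terminal_sp (glue (dmt G u v x y) H) p q"
      using 1 series by (intro two_terminal_sp.series[OF series.IH(1)]) simp_all
    with 1 show ?thesis by (simp add: dmt_glue)
  next
    case 2
    have "verts G \<inter> verts (dmt H u v x y) = {m}" using series.hyps(3) series.prems by (simp add: dmt_def)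
    then have "two_terminal_sp (glue G (dmt H u v x y)) p q"
      using 2 series by (intro two_terminal_sp.series[OF _ series.IH(2)]) simp_all
    with 2 show ?thesis by (simp add: dmt_glue_right)
  qed
next
  case (parallel G p q H)
  from parallel.prems(1) consider "{u, v} \<in># edges G" | "{u, v} \<in># edges H" by auto
  then show ?case
  proof cases
    case 1
    have "verts (dmt G u v x y) \<inter> verts H = {p, q}" using parallel.hyps(3) parallel.prems by (simp add: dmt_def)
    then have "two_terminal_sp (glue (dmt G u v x y) H) p q"
      using 1 parallel by (intro two_terminal_sp.parallel[OF parallel.IH(1)]) simp_all
    with 1 show ?thesis by (simp add: dmt_glue)
  next
    case 2
    have "verts G \<inter> verts (dmt H u v x y) = {p, q}" using parallel.hyps(3) parallel.prems by (simp add: dmt_def)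
    then have "two_terminal_sp (glue G (dmt H u v x y)) p q"
      using 2 parallel by (intro two_terminal_sp.parallel[OF _ parallel.IH(2)]) simp_all
    with 2 show ?thesis by (simp add: dmt_glue_right)
  qed
qed

lemma derives_two_terminal_sp:
  assumes "derives G H" "two_terminal_sp G p q"
  shows "two_terminal_sp H p q"
  using assms by induction (auto elim!: unrooted_step.cases intro: two_terminal_sp_dmt)

lemma two_terminal_sp_dipole3:
  assumes "p \<noteq> q"
  shows "two_terminal_sp (dipole 3 p q) p q"
proof -
  have "two_terminal_sp (glue (dipole 1 p q) (glue (dipole 1 p q) (dipole 1 p q))) p q"
    using assms by (intro parallel K2) (auto simp: dipole_def)
  then show ?thesis by (simp add: glue_def dipole_def numeral_3_eq_3)
qed

section \<open>Necklaces and double edges as starting graphs of networks\<close>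

definition double_link :: "'v \<Rightarrow> 'v \<Rightarrow> 'v set multiset" where
  "double_link a b = (if a = b then {#} else {#{a, b}, {a, b}#})"

text \<open>As \<open>double_link\<close> vanishes when its ends coincide, one formula covers roots
  of degree 1 (\<open>p' = p\<close> or \<open>q' = q\<close>) and roots of degree 2.\<close>

definition necklace :: "'v \<Rightarrow> 'v \<Rightarrow> 'v \<Rightarrow> 'v \<Rightarrow> 'v mgraph" where
  "necklace p p' q' q =
     MGraph {p, p', q', q} (double_link p p' + {#{p', q'}#} + double_link q' q)"

lemma verts_necklace [simp]: "verts (necklace p p' q' q) = {p, p', q', q}"
  by (simp add: necklace_def)

lemma verts_dipole [simp]: "verts (dipole n p q) = {p, q}"
  by (simp add: dipole_def)

lemma necklace_trivial: "necklace p p q q = dipole 1 p q"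
  by (simp add: necklace_def dipole_def double_link_def)

text \<open>The step on the middle edge yields \<open>p' - m = m' - r\<close>. Cut at
  \<open>m\<close>, this is a necklace ending in a plain edge followed by one starting with a double
  link; the next lemma has the double link on the other side of \<open>m\<close>.\<close>

lemma necklace_series_bead_right:
  assumes "{p, p'} \<inter> {r, q} = {}" "m \<noteq> m'" "{m, m'} \<inter> {p, p', r, q} = {}"
  shows "unrooted_step (necklace p p' r q) (glue (necklace p p' m m) (necklace m m' r q))"
  using assms
  by (intro unrooted_step_eqI[of p' r _ m m'])
    (auto simp: necklace_def dmt_def glue_def double_link_def insert_commute add_mset_commute)

lemma necklace_series_bead_left:
  assumes "{p, p'} \<inter> {r, q} = {}" "m \<noteq> m'" "{m, m'} \<inter> {p, p', r, q} = {}"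
  shows "unrooted_step (necklace p p' r q) (glue (necklace p p' m' m) (necklace m m r q))"
  using assms
  by (intro unrooted_step_eqI[of p' r _ m' m])
    (auto simp: necklace_def dmt_def glue_def double_link_def insert_commute add_mset_commute)

lemma dipole_necklace_series:
  assumes "p \<noteq> m"
  shows "glue (dipole 2 p m) (necklace m m r q) = necklace p m r q"
  using assms
  by (auto simp: necklace_def dipole_def glue_def double_link_def numeral_2_eq_2)

lemma necklace_dipole_series:
  assumes "q \<noteq> m"
  shows "glue (necklace p p' m m) (dipole 2 m q) = necklace p p' m q"
  using assms
  by (auto simp: necklace_def dipole_def glue_def double_link_def numeral_2_eq_2)

text \<open>The equivalences let the degree of a root decide whether it carries a double link, so a
  degree count at a gluing vertex tells which side has the link. Disjointness keeps the middle edge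
  from being a loop.\<close>

definition necklace_form :: "'v mgraph \<Rightarrow> 'v \<Rightarrow> 'v \<Rightarrow> bool" where
  "necklace_form G p q \<longleftrightarrow> (\<exists>p' q'. {p, p'} \<inter> {q', q} = {} \<and>
     (p' = p \<longleftrightarrow> degree G p = 1) \<and> (q' = q \<longleftrightarrow> degree G q = 1) \<and>
     derives (necklace p p' q' q) G)"

text \<open>This form arises from parallel composition: with roots of degree at most 2, each branch
  has degree 1 at both roots and reduces to a single edge.\<close>

definition bead_form :: "'v mgraph \<Rightarrow> 'v \<Rightarrow> 'v \<Rightarrow> bool" where
  "bead_form G p q \<longleftrightarrow> degree G p = 2 \<and> degree G q = 2 \<and> derives (dipole 2 p q) G"

lemma necklace_formD_simple:
  assumes "necklace_form G p q" "degree G p = 1" "degree G q = 1"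
  shows "derives (dipole 1 p q) G"
  using assms by (auto simp: necklace_form_def necklace_trivial)

text \<open>The three edges at \<open>m\<close> split as 1 + 2. Between two necklaces, the double
  link at \<open>m\<close> is produced by one dmt-step on a longer necklace; a double edge next to a
  necklace becomes the double link at the outer root.\<close>

lemma necklace_form_series:
  assumes G: "two_terminal_sp G p m" "necklace_form G p m \<or> bead_form G p m"
    and H: "two_terminal_sp H m q" "necklace_form H m q \<or> bead_form H m q"
    and GH: "verts G \<inter> verts H = {m}" and deg: "degree G m + degree H m = 3"
  shows "necklace_form (glue G H) p q"
proof -
  have pq: "p \<noteq> m" "m \<noteq> q" "p \<in> verts G" "q \<in> verts H" "m \<in> verts G" "m \<in> verts H"
    using two_terminal_sp_basic(1-3)[OF G(1)] two_terminal_sp_basic(1-3)[OF H(1)] by auto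
  with GH have "p \<notin> verts H" "q \<notin> verts G" by (metis IntI singletonD)+
  then have degs: "degree (glue G H) p = degree G p" "degree (glue G H) q = degree H q"
    using G(1) H(1) by (simp_all add: degree_glue degree_outside)
  \<comment> \<open>Two beads would give \<open>m\<close> degree 4, and a bead on one side forces
    degree 1 at \<open>m\<close> on the other.\<close>
  from G(2) H(2) deg consider
      (nn) "necklace_form G p m" "necklace_form H m q"
    | (bn) "bead_form G p m" "necklace_form H m q" "degree H m = 1"
    | (nb) "necklace_form G p m" "degree G m = 1" "bead_form H m q"
    by (auto simp: bead_form_def)
  then show ?thesis
  proof cases
    case nn
    then obtain p' s s' r where
      p': "{p, p'} \<inter> {s, m} = {}" "p' = p \<longleftrightarrow> degree G p = 1" "s = m \<longleftrightarrow> degree G m = 1"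
        "derives (necklace p p' s m) G" and
      r: "{m, s'} \<inter> {r, q} = {}" "s' = m \<longleftrightarrow> degree H m = 1" "r = q \<longleftrightarrow> degree H q = 1"
        "derives (necklace m s' r q) H"
      unfolding necklace_form_def by blast
    have sub: "{p, p', s, m} \<subseteq> verts G" "{m, s', r, q} \<subseteq> verts H"
      using derives_verts_mono[OF p'(4)] derives_verts_mono[OF r(4)] by auto
    have glue: "derives (glue (necklace p p' s m) (necklace m s' r q)) (glue G H)"
      using p'(4) r(4) GH by (intro derives_glue) auto
    have "p' \<in> verts G" "r \<in> verts H" "p' \<noteq> m" "r \<noteq> m" using sub p'(1) r(1) by auto
    with GH have "p' \<notin> verts H" "r \<notin> verts G" by (metis IntI singletonD)+
    then have disj: "{p, p'} \<inter> {r, q} = {}" "{m, s, s'} \<inter> {p, p', r, q} = {}"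
      using sub \<open>p \<notin> verts H\<close> \<open>q \<notin> verts G\<close> p'(1) r(1) by auto
    have "1 \<le> degree G m" "1 \<le> degree H m"
      using two_terminal_sp_degree_pos(2)[OF G(1)] two_terminal_sp_degree_pos(1)[OF H(1)] by simp_all
    \<comment> \<open>Exactly one of the two necklaces has a double link at
      \<open>m\<close>.\<close>
    with deg have "degree G m = 1 \<and> degree H m = 2 \<or> degree G m = 2 \<and> degree H m = 1" by linarith
    then have "s = m \<and> s' \<noteq> m \<or> s \<noteq> m \<and> s' = m" using p'(3) r(2) by auto
    then have "unrooted_step (necklace p p' r q) (glue (necklace p p' s m) (necklace m s' r q))"
    proof
      assume "s = m \<and> s' \<noteq> m"
      then show ?thesis using necklace_series_bead_right[of p p' r q m s'] disj by auto
    next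
      assume "s \<noteq> m \<and> s' = m"
      then show ?thesis using necklace_series_bead_left[of p p' r q m s] disj by auto
    qed
    with glue have "derives (necklace p p' r q) (glue G H)"
      by (rule converse_rtranclp_into_rtranclp[rotated])
    with disj(1) p'(2) r(3) degs show ?thesis unfolding necklace_form_def by auto
  next
    case bn
    then obtain r where
      r: "r \<noteq> m" "q \<noteq> m" "r = q \<longleftrightarrow> degree H q = 1" "derives (necklace m m r q) H"
      unfolding necklace_form_def by auto
    from bn have b: "degree G p = 2" "derives (dipole 2 p m) G" by (auto simp: bead_form_def)
    have "r \<in> verts H" using derives_verts_mono[OF r(4)] by auto
    have "derives (glue (dipole 2 p m) (necklace m m r q)) (glue G H)"
      using b(2) r(4) GH by (intro derives_glue) auto
    \<comment> \<open>The bead is now the double link at \<open>p\<close>, so \<open>m\<close> plays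
      the part of \<open>p'\<close>.\<close>
    then have "derives (necklace p m r q) (glue G H)"
      using pq by (simp add: dipole_necklace_series)
    moreover have "{p, m} \<inter> {r, q} = {}"
      using \<open>p \<notin> verts H\<close> \<open>r \<in> verts H\<close> pq r(1,2) by auto
    ultimately show ?thesis
      using b(1) degs r(3) pq unfolding necklace_form_def
      by (intro exI[of _ m] exI[of _ r]) auto
  next
    case nb
    then obtain p' where
      p': "m \<notin> {p, p'}" "p' = p \<longleftrightarrow> degree G p = 1" "derives (necklace p p' m m) G"
      unfolding necklace_form_def by auto
    from nb have b: "degree H q = 2" "derives (dipole 2 m q) H" by (auto simp: bead_form_def)
    have "p' \<in> verts G" using derives_verts_mono[OF p'(3)] by auto
    have "derives (glue (necklace p p' m m) (dipole 2 m q)) (glue G H)"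
      using b(2) p'(3) GH by (intro derives_glue) auto
    then have "derives (necklace p p' m q) (glue G H)"
      using pq by (simp add: necklace_dipole_series)
    moreover have "{p, p'} \<inter> {m, q} = {}"
      using \<open>q \<notin> verts G\<close> \<open>p' \<in> verts G\<close> pq p'(1) by auto
    ultimately show ?thesis
      using b(1) degs p'(2) pq unfolding necklace_form_def
      by (intro exI[of _ p'] exI[of _ m]) auto
  qed
qed

text \<open>Structural induction; the degree bound at the roots passes to the pieces because every
  piece uses at least one edge at each of its roots.\<close>

lemma two_terminal_sp_forms:
  assumes "two_terminal_sp G p q" "\<forall>v \<in> verts G - {p, q}. degree G v = 3"
    and "degree G p \<le> 2" "degree G q \<le> 2"
  shows "necklace_form G p q \<or> bead_form G p q"
  using assms
proof induction
  case (K2 p q)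
  then have "degree (dipole 1 p q) p = 1" "degree (dipole 1 p q) q = 1"
    by (simp_all add: degree_def dipole_def)
  with K2 show ?case
    unfolding necklace_form_def
    by (intro disjI1 exI[of _ p] exI[of _ q]) (simp add: necklace_trivial)
next
  case (series G p m H q)
  note G = series.hyps(1) and H = series.hyps(2) and GH = series.hyps(3)
  have pq: "p \<noteq> m" "m \<noteq> q" "p \<in> verts G" "q \<in> verts H" "m \<in> verts G"
    using two_terminal_sp_basic(1-3)[OF G] two_terminal_sp_basic(1-3)[OF H] by auto
  have pos: "1 \<le> degree G m" "1 \<le> degree H m"
    using two_terminal_sp_degree_pos(2)[OF G] two_terminal_sp_degree_pos(1)[OF H] by simp_all
  \<comment> \<open>In the composition \<open>m\<close> is an inner vertex, hence of degree
    3.\<close>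
  have dm: "degree G m + degree H m = 3"
    using series.prems(1) pq by (auto simp: degree_glue)
  have "degree G v = 3" if "v \<in> verts G - {p, m}" for v
  proof -
    have "v \<notin> verts H" using that GH by (metis DiffD1 DiffD2 IntI insertI1 insertCI singletonD)
    then have "degree H v = 0" using H by (rule degree_outside[rotated])
    moreover have "v \<in> verts (glue G H) - {p, q}" using that pq \<open>v \<notin> verts H\<close> by auto
    with series.prems(1) have "degree (glue G H) v = 3" by blast
    ultimately show ?thesis by (simp add: degree_glue)
  qed
  moreover have "degree H v = 3" if "v \<in> verts H - {m, q}" for v
  proof -
    have "v \<notin> verts G" using that GH by (metis DiffD1 DiffD2 IntI insertI1 insertCI singletonD)
    then have "degree G v = 0" using G by (rule degree_outside[rotated])
    moreover have "v \<in> verts (glue G H) - {p, q}" using that pq \<open>v \<notin> verts G\<close> by auto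
    with series.prems(1) have "degree (glue G H) v = 3" by blast
    ultimately show ?thesis by (simp add: degree_glue)
  qed
  moreover have "degree G p \<le> 2" "degree H q \<le> 2"
    using series.prems(2,3) by (simp_all add: degree_glue)
  moreover have "degree G m \<le> 2" "degree H m \<le> 2" using pos dm by auto
  ultimately show ?case
    using necklace_form_series[OF G _ H _ GH dm] series.IH by blast
next
  case (parallel G p q H)
  note G = parallel.hyps(1) and H = parallel.hyps(2) and GH = parallel.hyps(3)
  have pos: "1 \<le> degree G p" "1 \<le> degree H p" "1 \<le> degree G q" "1 \<le> degree H q"
    using two_terminal_sp_degree_pos[OF G] two_terminal_sp_degree_pos[OF H] by simp_all
  \<comment> \<open>Two positive degrees with sum at most 2 are both 1. This excludes beads, so both
    branches are necklaces without double links, that is, they derive from single edges.\<close>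
  then have one: "degree G p = 1" "degree H p = 1" "degree G q = 1" "degree H q = 1"
    using parallel.prems(2,3) by (auto simp: degree_glue)
  have "degree G v = 3" if "v \<in> verts G - {p, q}" for v
  proof -
    have "v \<notin> verts H" using that GH by (metis DiffD1 DiffD2 IntI insertI1 insertCI singletonD)
    moreover have "degree (glue G H) v = 3" using parallel.prems(1) that by simp
    ultimately show ?thesis using degree_outside[OF H] by (simp add: degree_glue)
  qed
  moreover have "degree H v = 3" if "v \<in> verts H - {p, q}" for v
  proof -
    have "v \<notin> verts G" using that GH by (metis DiffD1 DiffD2 IntI insertI1 insertCI singletonD)
    moreover have "degree (glue G H) v = 3" using parallel.prems(1) that by simp
    ultimately show ?thesis using degree_outside[OF G] by (simp add: degree_glue)
  qed
  ultimately have "necklace_form G p q" "necklace_form H p q"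
    using parallel.IH one by (auto simp: bead_form_def)
  then have "derives (glue (dipole 1 p q) (dipole 1 p q)) (glue G H)"
    using one GH by (intro derives_glue necklace_formD_simple) auto
  then have "derives (dipole 2 p q) (glue G H)"
    by (simp add: glue_def dipole_def numeral_2_eq_2)
  with one show ?case by (simp add: bead_form_def degree_glue)
qed

section \<open>Parallel and series composition at the top level\<close>

lemma derives_glue_parallel:
  assumes G: "two_terminal_sp G p q" and H: "two_terminal_sp H p q"
    and GH: "verts G \<inter> verts H = {p, q}"
    and reg: "regular 3 (glue G H)" and Gp: "degree G p = 1"
  shows "\<exists>a \<in> verts (glue G H). \<exists>b \<in> verts (glue G H). a \<noteq> b \<and> derives (dipole 3 a b) (glue G H)"
proof -
  have pq: "p \<noteq> q" "p \<in> verts G" "q \<in> verts G"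
    using two_terminal_sp_basic(1-3)[OF G] by auto
  have pos: "1 \<le> degree G q" "1 \<le> degree H q"
    using two_terminal_sp_degree_pos[OF G] two_terminal_sp_degree_pos[OF H] by simp_all
  have sum: "degree G p + degree H p = 3" "degree G q + degree H q = 3"
    using reg pq by (auto simp: regular_def degree_glue)
  have "\<forall>v \<in> verts G - {p, q}. degree G v = 3"
  proof
    fix v assume v: "v \<in> verts G - {p, q}"
    then have "v \<notin> verts H" using GH by auto
    moreover have "degree (glue G H) v = 3" using reg v by (simp add: regular_def)
    ultimately show "degree G v = 3" using degree_outside[OF H] by (simp add: degree_glue)
  qed
  moreover have "\<forall>v \<in> verts H - {p, q}. degree H v = 3"
  proof
    fix v assume v: "v \<in> verts H - {p, q}"
    then have "v \<notin> verts G" using GH by auto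
    moreover have "degree (glue G H) v = 3" using reg v by (simp add: regular_def)
    ultimately show "degree H v = 3" using degree_outside[OF G] by (simp add: degree_glue)
  qed
  \<comment> \<open>A bead has degree 2 at both roots, so \<open>Gp\<close> leaves only the necklace
    form for \<open>G\<close>.\<close>
  ultimately have forms: "necklace_form G p q" "necklace_form H p q \<or> bead_form H p q"
    using two_terminal_sp_forms[OF G] two_terminal_sp_forms[OF H] sum pos Gp
    by (auto simp: bead_form_def)
  have Hp: "degree H p = 2" using sum Gp by simp
  from forms(1) Gp obtain s where
    s: "s \<noteq> p" "s = q \<longleftrightarrow> degree G q = 1" "derives (necklace p p s q) G"
    by (auto simp: necklace_form_def)
  have sG: "s \<in> verts G" using derives_verts_mono[OF s(3)] by auto
  show ?thesis
    using forms(2)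
  proof
    assume b: "bead_form H p q"
    \<comment> \<open>With degree 1 at both roots, \<open>G\<close> derives from a single edge,
      which completes the double edge behind \<open>H\<close> to a triple edge.\<close>
    then have "degree G q = 1" using sum by (simp add: bead_form_def)
    then have "derives (glue (dipole 1 p q) (dipole 2 p q)) (glue G H)"
      using b s GH by (intro derives_glue) (auto simp: bead_form_def necklace_trivial)
    then have "derives (dipole 3 p q) (glue G H)"
      by (simp add: glue_def dipole_def numeral_2_eq_2 numeral_3_eq_3)
    with pq show ?thesis by auto
  next
    assume "necklace_form H p q"
    then obtain p' r where
      r: "{p, p'} \<inter> {r, q} = {}" "p' \<noteq> p" "r = q \<longleftrightarrow> degree H q = 1"
        "derives (necklace p p' r q) H"
      using Hp by (auto simp: necklace_form_def)
    have rH: "p' \<in> verts H" "r \<in> verts H" using derives_verts_mono[OF r(4)] by auto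
    have glue: "derives (glue (necklace p p s q) (necklace p p' r q)) (glue G H)"
      using s(3) r(4) GH by (intro derives_glue) auto
    have "p' \<notin> verts G" using rH r(1,2) GH by auto
    \<comment> \<open>The starting graph is a 4-cycle in which \<open>p = p'\<close> and the
      opposite edge at \<open>q\<close> are doubled. It results from the triple edge on
      \<open>p\<close> and \<open>p'\<close>, so \<open>p'\<close> replaces \<open>q\<close> as a
      root.\<close>
    have "unrooted_step (dipole 3 p p') (glue (necklace p p s q) (necklace p p' r q))"
    \<comment> \<open>The degrees at \<open>q\<close> also split as 1 + 2; the cases are whether the
      double link at \<open>q\<close> comes from \<open>H\<close> or from \<open>G\<close>.\<close>
    proof (cases "degree G q = 1")
      case True
      then have "s = q" "r \<noteq> q" using s(2) r(3) sum by auto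
      then show ?thesis
        using r pq by (intro unrooted_step_eqI[of p' p _ r q])
          (auto simp: necklace_def dipole_def dmt_def glue_def double_link_def numeral_3_eq_3
            insert_commute add_mset_commute)
    next
      case False
      then have "s \<noteq> q" "r = q" using s(2) r(3) sum pos by auto
      moreover have "s \<noteq> p'" using sG \<open>p' \<notin> verts G\<close> by auto
      ultimately show ?thesis
        using r pq s(1) by (intro unrooted_step_eqI[of p' p _ q s])
          (auto simp: necklace_def dipole_def dmt_def glue_def double_link_def numeral_3_eq_3
            insert_commute add_mset_commute)
    qed
    with glue have "derives (dipole 3 p p') (glue G H)"
      by (rule converse_rtranclp_into_rtranclp[rotated])
    with pq rH r(2) show ?thesis by (intro bexI[of _ p] bexI[of _ p']) auto
  qed
qed

text \<open>Without \<open>m\<close> no edge leads from \<open>G\<close> into \<open>H\<close>, so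
  \<open>p\<close> and \<open>q\<close> are separated.\<close>

lemma cut_vertex_series:
  assumes G: "two_terminal_sp G p m" and H: "two_terminal_sp H m q"
    and GH: "verts G \<inter> verts H = {m}" and conn: "connected_graph (glue G H)"
  shows "cut_vertex (glue G H) m"
proof -
  have pq: "p \<noteq> m" "m \<noteq> q" "p \<in> verts G" "q \<in> verts H" "m \<in> verts G"
    using two_terminal_sp_basic(1-3)[OF G] two_terminal_sp_basic(1-3)[OF H] by auto
  have "v \<in> verts G - {m}" if "joined (del_vertex (glue G H) m) p v" for v
    using that unfolding joined_def
  proof induction
    case (step v w)
    then consider "{v, w} \<in># edges G" "w \<noteq> m" | "{v, w} \<in># edges H"
      by (auto simp: adjacent_def del_vertex_def)
    then show ?case
    proof cases
      case 1
      then show ?thesis using two_terminal_sp_edges[OF G] by auto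
    next
      case 2
      \<comment> \<open>An edge of \<open>H\<close> would place \<open>v\<close> in both pieces,
        forcing \<open>v = m\<close> against the induction hypothesis.\<close>
      then have "v \<in> verts H" using two_terminal_sp_edges[OF H] by auto
      then show ?thesis using step.IH GH by auto
    qed
  qed (use pq in auto)
  moreover have "q \<notin> verts G" using pq GH by (metis IntI singletonD)
  moreover have "joined (glue G H) p q" using conn pq by (auto simp: connected_graph_def)
  ultimately show ?thesis
    unfolding cut_vertex_def using pq by (intro conjI bexI[of _ p] bexI[of _ q]) auto
qed

theorem theorem2p5:
  fixes G :: "'v mgraph"
  assumes "loopfree_mgraph G"
    and "connected_graph G"
    and "biconnected G"
    and "regular 3 G"
    and "series_parallel G"
  shows "\<exists>p \<in> verts G. \<exists>q \<in> verts G. p \<noteq> q \<and> two_terminal_sp G p q \<and>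
           dmt_step\<^sup>*\<^sup>* (dipole 3 p q, p, q) (G, p, q)"
proof -
  from assms(5) obtain p q where "two_terminal_sp G p q" by (auto simp: series_parallel_def)
  then have "\<exists>a \<in> verts G. \<exists>b \<in> verts G. a \<noteq> b \<and> derives (dipole 3 a b) G"
  proof cases
    case K2
    then show ?thesis using assms(4) by (auto simp: regular_def degree_def dipole_def)
  next
    case (series H m K)
    then have "cut_vertex G m" using cut_vertex_series[OF series(2-4)] assms(2) by simp
    then show ?thesis using assms(3) by (simp add: biconnected_def)
  next
    case (parallel H K)
    have "p \<in> verts G" using parallel by (simp add: two_terminal_sp_source)
    then have "degree H p + degree K p = 3"
      using assms(4) parallel(1) by (auto simp: regular_def degree_glue)
    moreover have "1 \<le> degree H p" "1 \<le> degree K p"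
      using parallel(2,3) by (simp_all only: two_terminal_sp_degree_pos)
    \<comment> \<open>The branch with degree 1 at \<open>p\<close> is used as the first piece;
      gluing is commutative.\<close>
    ultimately consider "degree H p = 1" | "degree K p = 1" by linarith
    then show ?thesis
    proof cases
      case 1
      then show ?thesis using derives_glue_parallel[of H p q K] parallel assms(4) by blast
    next
      case 2
      have "G = glue K H" using parallel(1) by (simp add: glue_commute)
      with 2 show ?thesis using derives_glue_parallel[of K p q H] parallel(2-) assms(4)
        by (simp add: Int_commute)
    qed
  qed
  then obtain a b where ab: "a \<in> verts G" "b \<in> verts G" "a \<noteq> b" "derives (dipole 3 a b) G"
    by blast
  \<comment> \<open>The roots \<open>a\<close> and \<open>b\<close> may differ from the given
    \<open>p\<close> and \<open>q\<close>; that \<open>G\<close> is a network between them is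
    inherited from the dipole along the derivation.\<close>
  moreover have "two_terminal_sp G a b"
    using ab two_terminal_sp_dipole3 derives_two_terminal_sp by metis
  ultimately show ?thesis using derives_dmt_step by metis
qed

end
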